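(* Let $D$ be an integral domain, let $\star$ be a stable semistar operation of finite type on $D$, and let $I$ be a nonzero finitely generated $D$-submodule of the quotient field $K$ of $D$. Then the following are equivalent: (i) $I$ is $\star$-invertible; (ii) for each $Q\in\mathcal{M}(\star)$, $ID_Q$ is an invertible fractional ideal of $D_Q$ (and then $ID_Q$ is principal in $D_Q$); (iii) $I\,\mathrm{Na}(D,\star)$ is an invertible fractional ideal of $\mathrm{Na}(D,\star)$; (iv) $I$ is quasi-$\star$-invertible.
   Context: Let $D$ be an integral domain with quotient field $K$; $\overline{F}(D)$ is the set of nonzero $D$-submodules of $K$. A semistar operation on $D$ is a map $\star:\overline{F}(D)\to\overline{F}(D)$, $E\mapsto E^\star$, such that for all $0\ne x\in K$ and $E,F\in\overline{F}(D)$: $(xE)^\star=xE^\star$; $E\subseteq F$ implies $E^\star\subseteq F^\star$; $E\subseteq E^\star$ and $(E^\star)^\star=E^\star$. The semistar operation of finite type associated to $\star$ is $\star_f$, defined by $E^{\star_f}=\bigcup\{F^\star : F\subseteq E,\ F \text{ a nonzero finitely generated } D\text{-submodule of } K\}$; $\star$ is of finite type if $\star=\star_f$. $\star$ is stable if $(E\cap F)^\star=E^\star\cap F^\star$ for all $E,F\in\overline{F}(D)$. For $E,F\in\overline{F}(D)$, $(E:F)=\{z\in K: zF\subseteq E\}$, and $I^{-1}=(D:I)$. A nonzero fractional ideal $I$ of $D$ is $\star$-invertible if $(II^{-1})^\star=D^\star$. An element $I\in\overline{F}(D)$ is quasi-$\star$-invertible if $(I(D^\star:I))^\star=D^\star$.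 A nonzero ideal $I\subseteq D$ is a quasi-$\star$-ideal if $I^\star\cap D=I$. $\mathcal{M}(\star)$ denotes the set of quasi-$\star$-maximal ideals, i.e. the maximal elements of the set of proper quasi-$\star$-ideals of $D$; when $\star$ is of finite type these are prime ideals. For $h\in D[X]$, $\boldsymbol{c}(h)$ is the content of $h$ (the ideal of $D$ generated by its coefficients). Put $N(\star)=\{h\in D[X]: h\neq 0,\ \boldsymbol{c}(h)^\star=D^\star\}$, a multiplicative subset of $D[X]$. The Nagata ring of $D$ with respect to $\star$ is $\mathrm{Na}(D,\star)=D[X]_{N(\star)}$. *)

theory Defs
  imports "HOL-Computational_Algebra.Computational_Algebra"
begin

(* An integral domain D is represented as a subring of its quotient field, which is the
   whole type 'k. The notions for a general subring R are used for R = D and R = D_Q inside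
   K, and for R = Na(D, star) inside K(X), which is the type 'k poly fract. *)

definition is_subring :: "'a::comm_ring_1 set \<Rightarrow> bool" where
  "is_subring R \<longleftrightarrow> 1 \<in> R \<and> (\<forall>x\<in>R. \<forall>y\<in>R. x - y \<in> R \<and> x * y \<in> R)"

definition domain_with_quotient_field :: "'k::field set \<Rightarrow> bool" where
  "domain_with_quotient_field D \<longleftrightarrow>
     is_subring D \<and> (\<forall>x. \<exists>a\<in>D. \<exists>b\<in>D. b \<noteq> 0 \<and> x = a / b)"

definition submodule :: "'a::comm_ring_1 set \<Rightarrow> 'a set \<Rightarrow> bool" where
  "submodule R E \<longleftrightarrow>
     0 \<in> E \<and> (\<forall>x\<in>E. \<forall>y\<in>E. x + y \<in> E) \<and> (\<forall>r\<in>R. \<forall>x\<in>E. r * x \<in> E)"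

definition mspan :: "'a::comm_ring_1 set \<Rightarrow> 'a set \<Rightarrow> 'a set" where
  "mspan R S = submodule R hull S"

definition fin_gen :: "'a::comm_ring_1 set \<Rightarrow> 'a set \<Rightarrow> bool" where
  "fin_gen R E \<longleftrightarrow> (\<exists>S. finite S \<and> E = mspan R S)"

definition mprod :: "'a::comm_ring_1 set \<Rightarrow> 'a set \<Rightarrow> 'a set \<Rightarrow> 'a set" where
  "mprod R E F = mspan R {x * y | x y. x \<in> E \<and> y \<in> F}"

definition colon :: "'a::comm_ring_1 set \<Rightarrow> 'a set \<Rightarrow> 'a set" where
  "colon E F = {z. \<forall>x\<in>F. z * x \<in> E}"

definition Fbar :: "'k::field set \<Rightarrow> 'k set set" where
  "Fbar D = {E. submodule D E \<and> E \<noteq> {0}}"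

definition fractional_ideal :: "'k::field set \<Rightarrow> 'k set \<Rightarrow> bool" where
  "fractional_ideal R J \<longleftrightarrow> submodule R J \<and> (\<exists>d\<in>R. d \<noteq> 0 \<and> (\<forall>x\<in>J. d * x \<in> R))"

definition invertible_fractional_ideal :: "'k::field set \<Rightarrow> 'k set \<Rightarrow> bool" where
  "invertible_fractional_ideal R J \<longleftrightarrow>
     fractional_ideal R J \<and> J \<noteq> {0} \<and> mprod R J (colon R J) = R"

definition is_principal :: "'k::field set \<Rightarrow> 'k set \<Rightarrow> bool" where
  "is_principal R J \<longleftrightarrow> (\<exists>x. J = mspan R {x})"

definition is_ideal :: "'k::field set \<Rightarrow> 'k set \<Rightarrow> bool" where
  "is_ideal D J \<longleftrightarrow> submodule D J \<and> J \<subseteq> D"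

(* Only the values of star on Fbar D are constrained; elsewhere star is arbitrary, so the
   notions below apply it to members of Fbar D only. *)

definition semistar_operation :: "'k::field set \<Rightarrow> ('k set \<Rightarrow> 'k set) \<Rightarrow> bool" where
  "semistar_operation D star \<longleftrightarrow>
     (\<forall>E\<in>Fbar D. star E \<in> Fbar D) \<and>
     (\<forall>x. \<forall>E\<in>Fbar D. x \<noteq> 0 \<longrightarrow> star ((\<lambda>y. x * y) ` E) = (\<lambda>y. x * y) ` star E) \<and>
     (\<forall>E\<in>Fbar D. \<forall>F\<in>Fbar D. E \<subseteq> F \<longrightarrow> star E \<subseteq> star F) \<and>
     (\<forall>E\<in>Fbar D. E \<subseteq> star E \<and> star (star E) = star E)"

definition star_f :: "'k::field set \<Rightarrow> ('k set \<Rightarrow> 'k set) \<Rightarrow> 'k set \<Rightarrow> 'k set" where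
  "star_f D star E = \<Union> {star F | F. F \<in> Fbar D \<and> fin_gen D F \<and> F \<subseteq> E}"

definition finite_type :: "'k::field set \<Rightarrow> ('k set \<Rightarrow> 'k set) \<Rightarrow> bool" where
  "finite_type D star \<longleftrightarrow> (\<forall>E\<in>Fbar D. star E = star_f D star E)"

(* The intersection of two nonzero D-submodules of the quotient field of D is nonzero. *)
definition stable_semistar :: "'k::field set \<Rightarrow> ('k set \<Rightarrow> 'k set) \<Rightarrow> bool" where
  "stable_semistar D star \<longleftrightarrow> (\<forall>E\<in>Fbar D. \<forall>F\<in>Fbar D. star (E \<inter> F) = star E \<inter> star F)"

definition star_invertible :: "'k::field set \<Rightarrow> ('k set \<Rightarrow> 'k set) \<Rightarrow> 'k set \<Rightarrow> bool" where
  "star_invertible D star J \<longleftrightarrow>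
     fractional_ideal D J \<and> J \<noteq> {0} \<and> star (mprod D J (colon D J)) = star D"

(* For J in Fbar D the module (star D : J) can be zero; then J (star D : J) is outside the
   domain of star and J does not count as quasi-star-invertible. *)
definition quasi_star_invertible :: "'k::field set \<Rightarrow> ('k set \<Rightarrow> 'k set) \<Rightarrow> 'k set \<Rightarrow> bool" where
  "quasi_star_invertible D star J \<longleftrightarrow>
     J \<in> Fbar D \<and> mprod D J (colon (star D) J) \<in> Fbar D \<and>
     star (mprod D J (colon (star D) J)) = star D"

definition quasi_star_ideal :: "'k::field set \<Rightarrow> ('k set \<Rightarrow> 'k set) \<Rightarrow> 'k set \<Rightarrow> bool" where
  "quasi_star_ideal D star J \<longleftrightarrow> is_ideal D J \<and> J \<noteq> {0} \<and> star J \<inter> D = J"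

definition quasi_star_maximal :: "'k::field set \<Rightarrow> ('k set \<Rightarrow> 'k set) \<Rightarrow> 'k set set" where
  "quasi_star_maximal D star =
     {Q. quasi_star_ideal D star Q \<and> Q \<noteq> D \<and>
         (\<forall>J. quasi_star_ideal D star J \<and> J \<noteq> D \<and> Q \<subseteq> J \<longrightarrow> J = Q)}"

(* The ring of fractions of A at S, realised inside the ambient field. *)
definition fractions :: "'k::field set \<Rightarrow> 'k set \<Rightarrow> 'k set" where
  "fractions A S = {a / s | a s. a \<in> A \<and> s \<in> S}"

definition localization_at :: "'k::field set \<Rightarrow> 'k set \<Rightarrow> 'k set" where
  "localization_at D Q = fractions D (D - Q)"

definition polys :: "'k::field set \<Rightarrow> 'k poly set" where
  "polys D = {p. \<forall>n. coeff p n \<in> D}"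

definition poly_content :: "'k::field set \<Rightarrow> 'k poly \<Rightarrow> 'k set" where
  "poly_content D h = mspan D (set (coeffs h))"

definition Nag_mult :: "'k::field set \<Rightarrow> ('k set \<Rightarrow> 'k set) \<Rightarrow> 'k poly set" where
  "Nag_mult D star = {h \<in> polys D. h \<noteq> 0 \<and> star (poly_content D h) = star D}"

definition Na :: "'k::field set \<Rightarrow> ('k set \<Rightarrow> 'k set) \<Rightarrow> 'k poly fract set" where
  "Na D star = fractions (to_fract ` polys D) (to_fract ` Nag_mult D star)"

definition const_fract :: "'k::field \<Rightarrow> 'k poly fract" where
  "const_fract x = to_fract [:x:]"

end

theory Submission
  imports Defs
begin

text \<open>All four conditions say that the ideal \<open>J = I (D : I)\<close> of \<open>D\<close> is large enough, each in its own
  measure of size.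

  For a finitely generated module, forming the inverse commutes with passing to a ring of fractions,
  because finitely many fractions have a common denominator. Hence \<open>I\<close> becomes invertible over
  \<open>fractions D S\<close> exactly when \<open>J\<close> meets \<open>S\<close> (\<open>invertible_over_fractions_iff\<close>). The localization at
  \<open>Q\<close> is the case where \<open>S\<close> is the complement of the prime \<open>Q\<close>, so there the condition is that \<open>J\<close>
  is not contained in \<open>Q\<close>. The Nagata ring is a ring of fractions of \<open>D[X]\<close>; over \<open>D[X]\<close> the product
  of the extended module and its inverse is \<open>J[X]\<close> (\<open>mspan_polys_product_colon\<close>), so here the
  condition is that some polynomial over \<open>J\<close> has content with closure \<open>star D\<close>.

  Both are equivalent to \<open>star J = star D\<close>, which is star-invertibility. For the maximal ideals this
  is Zorn's lemma (\<open>star_eq_star_D_iff_quasi_star_maximal\<close>): if \<open>1\<close> is not in \<open>star J\<close>, then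
  \<open>star J \<inter> D\<close> is a proper quasi-star-ideal and lies in a maximal one. For the polynomials it is
  finite type (\<open>star_eq_star_D_iff_Nag_mult\<close>): if \<open>1\<close> is in \<open>star J\<close>, finitely many elements of
  \<open>J\<close> suffice for this, and they serve as coefficients.

  Finally, stability gives that \<open>(star D : I)\<close> lies in the closure of \<open>(D : I)\<close>, a finite
  intersection of multiples of \<open>D\<close>. So \<open>I (star D : I)\<close> and \<open>J\<close> have the same closure, and
  quasi-star-invertibility agrees with star-invertibility. That an invertible localization is
  principal follows from the prime \<open>Q\<close> missing some single product \<open>g v\<close> with \<open>g\<close> in \<open>I\<close> and \<open>v\<close>
  in \<open>(D : I)\<close>; then \<open>g\<close> is a generator.\<close>

section \<open>Submodules and spans\<close>

lemma submoduleI: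
  assumes "0 \<in> E" "\<And>x y. x \<in> E \<Longrightarrow> y \<in> E \<Longrightarrow> x + y \<in> E"
    and "\<And>r x. r \<in> R \<Longrightarrow> x \<in> E \<Longrightarrow> r * x \<in> E"
  shows "submodule R E"
  using assms unfolding submodule_def by blast

lemma submodule_0: "submodule R E \<Longrightarrow> 0 \<in> E"
  and submodule_add: "submodule R E \<Longrightarrow> x \<in> E \<Longrightarrow> y \<in> E \<Longrightarrow> x + y \<in> E"
  and submodule_mult: "submodule R E \<Longrightarrow> r \<in> R \<Longrightarrow> x \<in> E \<Longrightarrow> r * x \<in> E"
  unfolding submodule_def by blast+

lemma submodule_sum:
  assumes "submodule R E" "\<And>i. i \<in> A \<Longrightarrow> f i \<in> E"
  shows "sum f A \<in> E"
  using assms(2)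
  by (induction A rule: infinite_finite_induct)
     (auto intro: submodule_0 submodule_add assms(1))

lemma submodule_Int: "submodule R E \<Longrightarrow> submodule R F \<Longrightarrow> submodule R (E \<inter> F)"
  unfolding submodule_def by blast

lemma submodule_vimage_mult:
  assumes "submodule R E"
  shows "submodule R {x. c * x \<in> E}"
proof (rule submoduleI)
  show "r * x \<in> {x. c * x \<in> E}" if "r \<in> R" "x \<in> {x. c * x \<in> E}" for r x
    using submodule_mult[OF assms that(1), of "c * x"] that(2) by (simp add: mult.left_commute)
qed (auto simp: distrib_left intro: submodule_0 submodule_add assms)

lemma submodule_image_mult:
  assumes "submodule R E"
  shows "submodule R ((\<lambda>x. c * x) ` E)"
proof (rule submoduleI)
  show "0 \<in> (\<lambda>x. c * x) ` E"
    using submodule_0[OF assms] by (auto intro!: image_eqI[of _ _ 0])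
next
  fix x y assume "x \<in> (\<lambda>x. c * x) ` E" "y \<in> (\<lambda>x. c * x) ` E"
  then show "x + y \<in> (\<lambda>x. c * x) ` E"
    using submodule_add[OF assms] by (auto simp: distrib_left[symmetric])
next
  fix r x assume "r \<in> R" "x \<in> (\<lambda>x. c * x) ` E"
  then show "r * x \<in> (\<lambda>x. c * x) ` E"
    using submodule_mult[OF assms] by (auto simp: mult.left_commute)
qed

lemma submodule_colon:
  assumes "submodule R E"
  shows "submodule R (colon E F)"
proof (rule submoduleI)
  show "r * x \<in> colon E F" if "r \<in> R" "x \<in> colon E F" for r x
    using that submodule_mult[OF assms] by (auto simp: colon_def mult.assoc)
qed (auto simp: colon_def distrib_right intro: submodule_0 submodule_add assms)

lemma submodule_mspan: "submodule R (mspan R S)"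
  unfolding mspan_def
proof (rule hull_in)
  show "submodule R (\<Inter>T)" if "Ball T (submodule R)" for T
    using that unfolding submodule_def by blast
qed

lemma mspan_superset: "S \<subseteq> mspan R S"
  unfolding mspan_def by (rule hull_subset)

lemma mspan_base: "x \<in> S \<Longrightarrow> x \<in> mspan R S"
  using mspan_superset by (rule subsetD)

lemma mspan_minimal: "S \<subseteq> E \<Longrightarrow> submodule R E \<Longrightarrow> mspan R S \<subseteq> E"
  unfolding mspan_def by (rule hull_minimal)

lemma mspan_mono: "S \<subseteq> T \<Longrightarrow> mspan R S \<subseteq> mspan R T"
  by (meson mspan_minimal mspan_superset submodule_mspan subset_trans)

lemma subring_minus: "is_subring R \<Longrightarrow> x \<in> R \<Longrightarrow> y \<in> R \<Longrightarrow> x - y \<in> R"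
  and subring_mult: "is_subring R \<Longrightarrow> x \<in> R \<Longrightarrow> y \<in> R \<Longrightarrow> x * y \<in> R"
  and subring_1: "is_subring R \<Longrightarrow> 1 \<in> R"
  unfolding is_subring_def by blast+

lemma subring_0: "is_subring R \<Longrightarrow> 0 \<in> R"
  using subring_minus[of R 1 1] subring_1[of R] by simp

lemma subring_uminus: "is_subring R \<Longrightarrow> x \<in> R \<Longrightarrow> - x \<in> R"
  using subring_minus[of R 0 x] subring_0[of R] by simp

lemma subring_add: "is_subring R \<Longrightarrow> x \<in> R \<Longrightarrow> y \<in> R \<Longrightarrow> x + y \<in> R"
  using subring_minus[of R x "- y"] subring_uminus[of R y] by simp

lemma submodule_self: "is_subring R \<Longrightarrow> submodule R R"
  by (rule submoduleI) (auto intro: subring_0 subring_add subring_mult)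

lemma colon_mspan: "submodule R E \<Longrightarrow> colon E (mspan R G) = colon E G"
proof
  assume E: "submodule R E"
  show "colon E G \<subseteq> colon E (mspan R G)"
  proof
    fix z assume "z \<in> colon E G"
    then have "mspan R G \<subseteq> {x. z * x \<in> E}"
      by (intro mspan_minimal submodule_vimage_mult E) (auto simp: colon_def)
    then show "z \<in> colon E (mspan R G)"
      by (auto simp: colon_def)
  qed
qed (use mspan_superset[of G R] in \<open>auto simp: colon_def\<close>)

lemma mprod_mspan_colon:
  assumes "is_subring R"
  shows "mprod R (mspan R G) (colon R (mspan R G)) =
    mspan R {g * v | g v. g \<in> G \<and> v \<in> colon R G}" (is "_ = ?P")
proof
  have "g * v \<in> ?P" if g: "g \<in> mspan R G" and v: "v \<in> colon R G" for g v
  proof -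
    have "mspan R G \<subseteq> {x. v * x \<in> ?P}"
      using v
      by (intro mspan_minimal submodule_vimage_mult submodule_mspan)
         (auto intro!: mspan_base simp: mult.commute[of v])
    with g show ?thesis
      by (auto simp: mult.commute)
  qed
  then show "mprod R (mspan R G) (colon R (mspan R G)) \<subseteq> ?P"
    unfolding mprod_def colon_mspan[OF submodule_self[OF assms]]
    by (intro mspan_minimal submodule_mspan) auto
  show "?P \<subseteq> mprod R (mspan R G) (colon R (mspan R G))"
    unfolding mprod_def colon_mspan[OF submodule_self[OF assms]]
    using mspan_superset[of G R] by (intro mspan_mono) blast
qed

section \<open>Invertibility over a ring of fractions\<close>

lemma is_subring_fractions:
  fixes A :: "'a::field set"
  assumes A: "is_subring A" and "S \<subseteq> A" "1 \<in> S" "0 \<notin> S"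
    and S: "\<And>s t. s \<in> S \<Longrightarrow> t \<in> S \<Longrightarrow> s * t \<in> S"
  shows "is_subring (fractions A S)"
  unfolding is_subring_def
proof (intro conjI ballI)
  show "1 \<in> fractions A S"
    using subring_1[OF A] assms(3) by (auto simp: fractions_def intro!: exI[of _ 1])
  fix x y assume "x \<in> fractions A S" "y \<in> fractions A S"
  then obtain a s b t where ab: "a \<in> A" "s \<in> S" "b \<in> A" "t \<in> S" "x = a / s" "y = b / t"
    by (auto simp: fractions_def)
  then have nz: "s \<noteq> 0" "t \<noteq> 0" and in_A: "s \<in> A" "t \<in> A"
    using assms by auto
  have "x - y = (a * t - b * s) / (s * t)" "x * y = (a * b) / (s * t)"
    using ab nz by (auto simp: field_simps)
  then show "x - y \<in> fractions A S" "x * y \<in> fractions A S"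
    unfolding fractions_def
    using ab in_A S by (blast intro: subring_minus[OF A] subring_mult[OF A])+
qed

lemma subset_fractions: "1 \<in> S \<Longrightarrow> A \<subseteq> fractions A S"
  unfolding fractions_def by (force intro: exI[of _ 1])

text \<open>The values of a multiplier on the finitely many generators are fractions that can be brought to
  a common denominator. Hence every multiplier of \<open>G\<close> into the ring of fractions becomes, after scaling
  by one element of \<open>S\<close>, a multiplier of \<open>G\<close> into the ring itself.\<close>

lemma common_denominator:
  fixes A :: "'a::field set"
  assumes A: "is_subring A" and SA: "S \<subseteq> A" and S: "1 \<in> S" "0 \<notin> S"
    "\<And>s t. s \<in> S \<Longrightarrow> t \<in> S \<Longrightarrow> s * t \<in> S"
    and F: "finite F" "F \<subseteq> G" "G \<subseteq> mspan A F"
    and v: "v \<in> colon (fractions A S) G"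
  obtains s where "s \<in> S" "s * v \<in> colon A G"
proof -
  have "\<exists>s\<in>S. s * v \<in> colon A F"
    using F(1,2)
  proof (induction F rule: finite_induct)
    case empty
    then show ?case using S(1) by (auto simp: colon_def)
  next
    case (insert x F)
    then obtain s where s: "s \<in> S" "s * v \<in> colon A F" by auto
    from insert v have "v * x \<in> fractions A S" by (auto simp: colon_def)
    then obtain a t where a: "a \<in> A" "t \<in> S" "v * x = a / t" by (auto simp: fractions_def)
    then have "t \<noteq> 0" using S(2) by auto
    with a have tvx: "t * (v * x) = a" by simp
    have "(s * t) * v * y \<in> A" if "y \<in> insert x F" for y
    proof (cases "y = x")
      case True
      have "(s * t) * v * x = s * a" using tvx by (simp add: mult_ac)
      also have "\<dots> \<in> A" using s(1) a(1) SA by (intro subring_mult[OF A]) auto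
      finally show ?thesis using True by simp
    next
      case False
      then have "s * v * y \<in> A" using that s(2) by (auto simp: colon_def)
      then have "t * (s * v * y) \<in> A" using a(2) SA subring_mult[OF A] by auto
      then show ?thesis by (simp add: mult_ac)
    qed
    then show ?case using S(3)[OF s(1) a(2)] by (auto simp: colon_def)
  qed
  then obtain s where s: "s \<in> S" "s * v \<in> colon A F" ..
  have "colon A F = colon A (mspan A F)"
    by (simp add: colon_mspan submodule_self A)
  also have "\<dots> \<subseteq> colon A G"
    using F(3) by (auto simp: colon_def)
  finally show ?thesis using s that by blast
qed

text \<open>Both localizations at primes of \<open>D\<close> and the Nagata ring are rings of fractions, and this
  criterion treats them alike. Over \<open>fractions A S\<close> the product of the extended module and its
  inverse is the extension of the product \<open>G (A : G)\<close> formed over \<open>A\<close>; an extended ideal is the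
  whole ring exactly when the ideal meets the multiplicative set.\<close>

lemma invertible_over_fractions_iff:
  fixes A :: "'a::field set"
  assumes A: "is_subring A" and SA: "S \<subseteq> A" and S: "1 \<in> S" "0 \<notin> S"
    "\<And>s t. s \<in> S \<Longrightarrow> t \<in> S \<Longrightarrow> s * t \<in> S"
    and F: "finite F" "F \<subseteq> G" "G \<subseteq> mspan A F"
    and nz: "\<exists>g\<in>G. g \<noteq> 0"
    and d: "d \<noteq> 0" "d \<in> A" "d \<in> colon A G"
  defines "R \<equiv> fractions A S"
  shows "invertible_fractional_ideal R (mspan R G) \<longleftrightarrow>
    (\<exists>s\<in>S. s \<in> mspan A {g * v | g v. g \<in> G \<and> v \<in> colon A G})"
    (is "_ \<longleftrightarrow> (\<exists>s\<in>S. s \<in> ?P)")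
proof -
  have R: "is_subring R"
    unfolding R_def by (rule is_subring_fractions) (use assms in auto)
  have AR: "A \<subseteq> R"
    unfolding R_def using S(1) by (rule subset_fractions)
  let ?T = "mspan R {g * v | g v. g \<in> G \<and> v \<in> colon R G}"
  have nonzero: "mspan R G \<noteq> {0}"
    using nz mspan_superset[of G R] by blast
  have "d \<in> colon R G"
    using d(3) AR by (auto simp: colon_def)
  then have "d \<in> colon R (mspan R G)"
    by (simp add: colon_mspan submodule_self R)
  then have frac: "fractional_ideal R (mspan R G)"
    unfolding fractional_ideal_def using d AR
    by (auto simp: submodule_mspan colon_def intro!: bexI[of _ d])
  have TR: "?T \<subseteq> R"
    by (intro mspan_minimal submodule_self R) (auto simp: colon_def mult.commute)
  have "?T = R \<longleftrightarrow> 1 \<in> ?T"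
  proof
    assume "1 \<in> ?T"
    then have "r * 1 \<in> ?T" if "r \<in> R" for r
      by (rule submodule_mult[OF submodule_mspan that])
    then show "?T = R" using TR by auto
  qed (use subring_1[OF R] in simp)
  also have "\<dots> \<longleftrightarrow> (\<exists>s\<in>S. s \<in> ?P)"
  proof
    \<comment> \<open>The elements that some denominator moves into \<open>G (A : G)\<close> form an \<open>R\<close>-module containing all
      products, so they include \<open>1\<close> as soon as the span over \<open>R\<close> does.\<close>
    let ?W = "{w. \<exists>s\<in>S. s * w \<in> ?P}"
    have "submodule R ?W"
    proof (rule submoduleI)
      show "0 \<in> ?W" using S(1) submodule_0[OF submodule_mspan] by (auto intro!: bexI[of _ 1])
    next
      fix x y assume "x \<in> ?W" "y \<in> ?W"
      then obtain s t where st: "s \<in> S" "s * x \<in> ?P" "t \<in> S" "t * y \<in> ?P" by auto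
      then have "t * (s * x) + s * (t * y) \<in> ?P"
        using SA submodule_mult[OF submodule_mspan] by (blast intro: submodule_add[OF submodule_mspan])
      then have "(s * t) * (x + y) \<in> ?P" by (simp add: algebra_simps)
      then show "x + y \<in> ?W" using S(3)[OF st(1,3)] by auto
    next
      fix r x assume "r \<in> R" "x \<in> ?W"
      then obtain a t s where st: "a \<in> A" "t \<in> S" "r = a / t" "s \<in> S" "s * x \<in> ?P"
        unfolding R_def by (auto simp: fractions_def)
      then have "t \<noteq> 0" using S(2) by auto
      then have "(s * t) * (r * x) = a * (s * x)" using st(3) by simp
      moreover have "a * (s * x) \<in> ?P" using submodule_mult[OF submodule_mspan st(1,5)] .
      ultimately show "r * x \<in> ?W" using S(3)[OF st(4,2)] by (metis (no_types, lifting) mem_Collect_eq)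
    qed
    moreover have "g * v \<in> ?W" if gv: "g \<in> G" "v \<in> colon R G" for g v
    proof -
      obtain s where s: "s \<in> S" "s * v \<in> colon A G"
        using common_denominator[OF A SA S F, of v] gv(2) unfolding R_def by blast
      then have "g * (s * v) \<in> ?P"
        using gv(1) by (intro mspan_base) blast
      then show ?thesis using s(1) by (auto simp: mult.left_commute)
    qed
    ultimately have "?T \<subseteq> ?W"
      by (intro mspan_minimal) auto
    moreover assume "1 \<in> ?T"
    ultimately have "1 \<in> ?W" by (rule subsetD)
    then show "\<exists>s\<in>S. s \<in> ?P" by simp
  next
    assume "\<exists>s\<in>S. s \<in> ?P"
    then obtain s where s: "s \<in> S" "s \<in> ?P" ..
    have "submodule A ?T"
      using submodule_mspan[of R] AR unfolding submodule_def by blast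
    moreover have "{g * v | g v. g \<in> G \<and> v \<in> colon A G} \<subseteq> ?T"
      using AR by (auto simp: colon_def intro!: mspan_base)
    ultimately have "s \<in> ?T"
      using mspan_minimal s(2) by blast
    moreover have "1 / s \<in> R"
      using subring_1[OF A] s(1) by (auto simp: R_def fractions_def)
    ultimately have "(1 / s) * s \<in> ?T"
      by (intro submodule_mult[OF submodule_mspan])
    moreover have "s \<noteq> 0" using s(1) S(2) by auto
    ultimately show "1 \<in> ?T" by simp
  qed
  finally show ?thesis
    unfolding invertible_fractional_ideal_def mprod_mspan_colon[OF R]
    using frac nonzero by simp
qed

text \<open>A product \<open>g v\<close> that becomes a unit lets \<open>g\<close> generate everything, because
  \<open>x = (v x / (g v)) g\<close> for each \<open>x\<close> in \<open>G\<close>.\<close>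

lemma is_principal_if_unit_product:
  fixes A :: "'a::field set"
  assumes "g \<in> G" "v \<in> colon A G" "g * v \<in> S" "0 \<notin> S"
  shows "is_principal (fractions A S) (mspan (fractions A S) G)"
proof -
  let ?R = "fractions A S"
  have "x \<in> mspan ?R {g}" if "x \<in> G" for x
  proof -
    have "v * x / (g * v) \<in> ?R"
      using that assms(2,3) unfolding fractions_def colon_def by blast
    moreover have "g \<in> mspan ?R {g}" by (rule mspan_base) simp
    ultimately have "(v * x / (g * v)) * g \<in> mspan ?R {g}"
      by (rule submodule_mult[OF submodule_mspan])
    moreover have "g * v \<noteq> 0" using assms(3,4) by metis
    ultimately show ?thesis by simp
  qed
  then have "mspan ?R G \<subseteq> mspan ?R {g}"
    by (intro mspan_minimal submodule_mspan) auto
  moreover have "mspan ?R {g} \<subseteq> mspan ?R G"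
    using assms(1) by (intro mspan_mono) auto
  ultimately show ?thesis unfolding is_principal_def by blast
qed

section \<open>Polynomials with coefficients in a submodule\<close>

lemma polys_mult:
  assumes "submodule D J" "f \<in> polys D" "g \<in> polys J"
  shows "f * g \<in> polys J"
  using assms unfolding polys_def
  by (auto simp: coeff_mult intro!: submodule_sum[OF assms(1)] submodule_mult[OF assms(1)])

lemma is_subring_polys:
  assumes "is_subring D"
  shows "is_subring (polys D)"
  unfolding is_subring_def
proof (intro conjI ballI)
  show "1 \<in> polys D"
    using subring_0[OF assms] subring_1[OF assms] by (auto simp: polys_def coeff_1)
  show "f - g \<in> polys D" if "f \<in> polys D" "g \<in> polys D" for f g
    using that subring_minus[OF assms] by (auto simp: polys_def)
  show "f * g \<in> polys D" if "f \<in> polys D" "g \<in> polys D" for f g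
    using polys_mult[OF submodule_self[OF assms] that] .
qed

lemma is_subring_to_fract_image:
  assumes "is_subring (P :: 'a::idom set)"
  shows "is_subring (to_fract ` P)"
  unfolding is_subring_def
proof (intro conjI ballI)
  show "1 \<in> to_fract ` P"
    using subring_1[OF assms] by (force intro: image_eqI[of _ _ 1])
  fix x y assume "x \<in> to_fract ` P" "y \<in> to_fract ` P"
  then show "x - y \<in> to_fract ` P" "x * y \<in> to_fract ` P"
    using subring_minus[OF assms] subring_mult[OF assms]
    by (auto simp flip: to_fract_diff to_fract_mult)
qed

lemma set_coeffs_subset_iff:
  "0 \<in> E \<Longrightarrow> set (coeffs h) \<subseteq> E \<longleftrightarrow> h \<in> polys E"
proof -
  assume "0 \<in> E"
  moreover have "h \<in> polys E \<longleftrightarrow> range (coeff h) \<subseteq> E"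
    by (auto simp: polys_def)
  ultimately show ?thesis by (simp add: range_coeff)
qed

text \<open>For a prime ideal \<open>Q\<close> the polynomials over \<open>Q\<close> form a prime ideal as well: in a product,
  look at the coefficient whose index is the sum of the first indices at which the factors leave
  \<open>Q\<close>. All of its summands but one lie in \<open>Q\<close>.\<close>

lemma polys_prime:
  assumes D: "is_subring D" and Q: "submodule D Q"
    and prime: "\<And>a b. a \<in> D \<Longrightarrow> b \<in> D \<Longrightarrow> a * b \<in> Q \<Longrightarrow> a \<in> Q \<or> b \<in> Q"
    and fg: "f \<in> polys D" "g \<in> polys D" "f \<notin> polys Q" "g \<notin> polys Q"
  shows "f * g \<notin> polys Q"
proof
  assume prod: "f * g \<in> polys Q"
  define i where "i = (LEAST n. coeff f n \<notin> Q)"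
  define j where "j = (LEAST n. coeff g n \<notin> Q)"
  have i: "coeff f i \<notin> Q" and j: "coeff g j \<notin> Q"
    unfolding i_def j_def using fg(3,4) by (auto simp: polys_def intro!: LeastI_ex[of "\<lambda>n. _ n \<notin> Q"])
  have less_i: "coeff f n \<in> Q" if "n < i" for n
    using not_less_Least that unfolding i_def by blast
  have less_j: "coeff g n \<in> Q" if "n < j" for n
    using not_less_Least that unfolding j_def by blast
  have in_D: "coeff f n \<in> D" "coeff g n \<in> D" for n
    using fg by (auto simp: polys_def)
  let ?t = "\<lambda>k. coeff f k * coeff g (i + j - k)"
  have "?t k \<in> Q" if "k \<in> {..i + j} - {i}" for k
  proof (cases "k < i")
    case True
    then show ?thesis
      using submodule_mult[OF Q in_D(2) less_i] by (simp add: mult.commute)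
  next
    case False
    with that have "i + j - k < j" by auto
    then show ?thesis using submodule_mult[OF Q in_D(1) less_j] by blast
  qed
  then have rest: "(\<Sum>k\<in>{..i + j} - {i}. ?t k) \<in> Q"
    by (rule submodule_sum[OF Q])
  have "coeff (f * g) (i + j) = ?t i + (\<Sum>k\<in>{..i + j} - {i}. ?t k)"
    unfolding coeff_mult by (subst sum.remove[of _ i]) auto
  then have "coeff f i * coeff g j =
      coeff (f * g) (i + j) + (- 1) * (\<Sum>k\<in>{..i + j} - {i}. ?t k)"
    by simp
  also have "\<dots> \<in> Q"
    using prod subring_uminus[OF D subring_1[OF D]] rest
    by (intro submodule_add[OF Q] submodule_mult[OF Q]) (auto simp: polys_def)
  finally show False
    using prime[OF in_D(1) in_D(2)] i j by blast
qed

lemma const_fract_mult: "const_fract (x * y) = const_fract x * const_fract y"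
  and const_fract_add: "const_fract (x + y) = const_fract x + const_fract y"
  and const_fract_0 [simp]: "const_fract 0 = 0"
  and const_fract_eq_0_iff [simp]: "const_fract x = 0 \<longleftrightarrow> x = 0"
  by (simp_all add: const_fract_def flip: to_fract_mult to_fract_add)

lemma const_fract_in_polys_iff:
  assumes "0 \<in> E"
  shows "const_fract x \<in> to_fract ` polys E \<longleftrightarrow> x \<in> E"
proof
  assume "const_fract x \<in> to_fract ` polys E"
  then have "[:x:] \<in> polys E" by (auto simp: const_fract_def)
  then have "coeff [:x:] 0 \<in> E" unfolding polys_def by blast
  then show "x \<in> E" by simp
next
  assume "x \<in> E"
  then show "const_fract x \<in> to_fract ` polys E"
    using assms by (auto simp: const_fract_def polys_def coeff_pCons split: nat.split)
qed

text \<open>A multiplier of \<open>I\<close> into \<open>D[X]\<close> is automatically a polynomial over the quotient field, since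
  it becomes one after multiplication by a nonzero constant from \<open>I\<close>; its coefficients then lie in
  \<open>(D : I)\<close>. So forming \<open>I (D : I)\<close> commutes with passing from \<open>D\<close> to \<open>D[X]\<close>.\<close>

lemma mspan_polys_product_colon:
  fixes D :: "'k::field set"
  assumes D: "is_subring D" and nz: "x0 \<in> I" "x0 \<noteq> 0"
  defines "A \<equiv> to_fract ` polys D"
  shows "mspan A {g * v | g v. g \<in> const_fract ` I \<and> v \<in> colon A (const_fract ` I)} =
    to_fract ` polys (mprod D I (colon D I))" (is "mspan A ?G = to_fract ` polys ?J")
proof
  have J: "submodule D ?J"
    unfolding mprod_def by (rule submodule_mspan)
  have "submodule A (to_fract ` polys ?J)"
  proof (rule submoduleI)
    show "0 \<in> to_fract ` polys ?J"
      using submodule_0[OF J] by (auto simp: polys_def intro!: image_eqI[of _ _ 0])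
    show "x + y \<in> to_fract ` polys ?J"
      if "x \<in> to_fract ` polys ?J" "y \<in> to_fract ` polys ?J" for x y
      using that submodule_add[OF J] by (auto simp: polys_def simp flip: to_fract_add)
    show "r * x \<in> to_fract ` polys ?J" if "r \<in> A" "x \<in> to_fract ` polys ?J" for r x
      using that polys_mult[OF J] unfolding A_def by (auto simp flip: to_fract_mult)
  qed
  moreover have "?G \<subseteq> to_fract ` polys ?J"
  proof clarify
    fix x v assume x: "x \<in> I" and v: "v \<in> colon A (const_fract ` I)"
    from v nz(1) have "v * const_fract x0 \<in> A" by (auto simp: colon_def)
    then obtain f where f: "v * const_fract x0 = to_fract f" by (auto simp: A_def)
    define p where "p = smult (1 / x0) f"
    have "to_fract p * const_fract x0 = to_fract f"
      using nz(2) by (simp add: p_def const_fract_def flip: to_fract_mult)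
    with f nz(2) have vp: "v = to_fract p"
      by (metis const_fract_eq_0_iff mult_cancel_right)
    have mult_p: "const_fract y * v = to_fract (smult y p)" for y
      by (simp add: vp const_fract_def flip: to_fract_mult)
    have "smult y p \<in> polys D" if "y \<in> I" for y
    proof -
      have "const_fract y * v \<in> A"
        using v that by (auto simp: colon_def mult.commute)
      then show ?thesis by (auto simp: mult_p A_def)
    qed
    then have "coeff p n \<in> colon D I" for n
      by (auto simp: polys_def colon_def mult.commute)
    then have "x * coeff p n \<in> ?J" for n
      using x unfolding mprod_def by (intro mspan_base) blast
    then have "smult x p \<in> polys ?J" by (simp add: polys_def)
    then show "const_fract x * v \<in> to_fract ` polys ?J" by (auto simp: mult_p)
  qed
  ultimately show "mspan A ?G \<subseteq> to_fract ` polys ?J"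
    by (intro mspan_minimal)
next
  let ?C = "{c. const_fract c \<in> mspan A ?G}"
  have const_A: "const_fract d \<in> A" if "d \<in> D" for d
    unfolding A_def using that const_fract_in_polys_iff[OF subring_0[OF D]] by blast
  have "submodule D ?C"
    by (rule submoduleI)
       (auto simp: const_fract_add const_fract_mult const_A
         intro: submodule_0[OF submodule_mspan] submodule_add[OF submodule_mspan]
           submodule_mult[OF submodule_mspan])
  moreover have "x * y \<in> ?C" if "x \<in> I" "y \<in> colon D I" for x y
  proof -
    have "const_fract y \<in> colon A (const_fract ` I)"
      using that(2) const_A by (auto simp: colon_def simp flip: const_fract_mult)
    then show ?thesis
      using that(1) by (auto simp: const_fract_mult intro!: mspan_base)
  qed
  ultimately have J: "?J \<subseteq> ?C"
    unfolding mprod_def by (intro mspan_minimal) auto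
  show "to_fract ` polys ?J \<subseteq> mspan A ?G"
  proof clarify
    fix h assume h: "h \<in> polys ?J"
    have "to_fract h = (\<Sum>i\<le>degree h. to_fract (monom (coeff h i) i))"
      by (metis poly_as_sum_of_monoms to_fract_sum)
    also have "\<dots> = (\<Sum>i\<le>degree h. to_fract (monom 1 i) * const_fract (coeff h i))"
      by (simp add: const_fract_def smult_monom flip: to_fract_mult)
    also have "\<dots> \<in> mspan A ?G"
    proof (rule submodule_sum[OF submodule_mspan], rule submodule_mult[OF submodule_mspan])
      show "to_fract (monom 1 i) \<in> A" for i
        using subring_0[OF D] subring_1[OF D] by (auto simp: A_def polys_def)
      show "const_fract (coeff h i) \<in> mspan A ?G" for i
        using h J by (auto simp: polys_def)
    qed
    finally show "to_fract h \<in> mspan A ?G" .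
  qed
qed

section \<open>Stable semistar operations of finite type\<close>

locale stable_finite_semistar =
  fixes D :: "'k::field set" and star :: "'k set \<Rightarrow> 'k set"
  assumes quotient_field: "domain_with_quotient_field D"
    and semistar: "semistar_operation D star"
    and stable: "stable_semistar D star"
    and finite_type: "finite_type D star"
begin

lemma D: "is_subring D"
  using quotient_field by (simp add: domain_with_quotient_field_def)

lemma star_Fbar: "E \<in> Fbar D \<Longrightarrow> star E \<in> Fbar D"
  and star_mult: "E \<in> Fbar D \<Longrightarrow> x \<noteq> 0 \<Longrightarrow> star ((\<lambda>y. x * y) ` E) = (\<lambda>y. x * y) ` star E"
  and star_mono: "E \<in> Fbar D \<Longrightarrow> F \<in> Fbar D \<Longrightarrow> E \<subseteq> F \<Longrightarrow> star E \<subseteq> star F"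
  and star_extensive: "E \<in> Fbar D \<Longrightarrow> E \<subseteq> star E"
  and star_idem: "E \<in> Fbar D \<Longrightarrow> star (star E) = star E"
  using semistar unfolding semistar_operation_def by simp_all

lemma star_Int: "E \<in> Fbar D \<Longrightarrow> F \<in> Fbar D \<Longrightarrow> star (E \<inter> F) = star E \<inter> star F"
  using stable unfolding stable_semistar_def by simp

lemma star_finite_type:
  assumes "E \<in> Fbar D" "x \<in> star E"
  obtains F where "F \<in> Fbar D" "fin_gen D F" "F \<subseteq> E" "x \<in> star F"
  using assms finite_type unfolding finite_type_def star_f_def by blast

lemma FbarI: "submodule D E \<Longrightarrow> x \<in> E \<Longrightarrow> x \<noteq> 0 \<Longrightarrow> E \<in> Fbar D"
  by (auto simp: Fbar_def)

lemma Fbar_submodule: "E \<in> Fbar D \<Longrightarrow> submodule D E"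
  by (simp add: Fbar_def)

lemma Fbar_nonzero:
  assumes "E \<in> Fbar D"
  obtains x where "x \<in> E" "x \<noteq> 0"
  using assms submodule_0 unfolding Fbar_def by blast

lemma Fbar_superset: "E \<in> Fbar D \<Longrightarrow> E \<subseteq> F \<Longrightarrow> submodule D F \<Longrightarrow> F \<in> Fbar D"
  by (metis Fbar_nonzero FbarI subsetD)

lemma D_Fbar: "D \<in> Fbar D"
  using FbarI[OF submodule_self[OF D] subring_1[OF D]] by simp

text \<open>The module \<open>star E\<close> is closed, so it contains \<open>star D\<close> as soon as it contains \<open>1\<close>.\<close>

lemma star_eq_star_D_iff:
  assumes "E \<in> Fbar D" "E \<subseteq> star D"
  shows "star E = star D \<longleftrightarrow> 1 \<in> star E"
proof
  assume one: "1 \<in> star E"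
  have "D \<subseteq> star E"
  proof
    fix d assume "d \<in> D"
    then have "d * 1 \<in> star E"
      using one by (rule submodule_mult[OF Fbar_submodule[OF star_Fbar[OF assms(1)]]])
    then show "d \<in> star E" by simp
  qed
  then have "star D \<subseteq> star E"
    using star_mono[OF D_Fbar star_Fbar[OF assms(1)]] star_idem[OF assms(1)] by simp
  moreover have "star E \<subseteq> star D"
    using star_mono[OF assms(1) star_Fbar[OF D_Fbar] assms(2)] star_idem[OF D_Fbar] by simp
  ultimately show "star E = star D" by blast
qed (use star_extensive[OF D_Fbar] subring_1[OF D] in auto)

lemma D_subset_star_D: "D \<subseteq> star D"
  using star_extensive[OF D_Fbar] .

lemma quasi_star_ideal_Fbar: "quasi_star_ideal D star Q \<Longrightarrow> Q \<in> Fbar D"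
  by (simp add: quasi_star_ideal_def is_ideal_def Fbar_def)

lemma quasi_star_ideal_eq_D_iff:
  assumes "quasi_star_ideal D star Q"
  shows "Q = D \<longleftrightarrow> 1 \<in> Q"
proof
  assume "1 \<in> Q"
  moreover have Q: "submodule D Q" "Q \<subseteq> D"
    using assms by (auto simp: quasi_star_ideal_def is_ideal_def)
  ultimately have "d * 1 \<in> Q" if "d \<in> D" for d
    by (rule_tac submodule_mult[OF Q(1) that])
  then show "Q = D" using Q(2) by auto
qed (use subring_1[OF D] in auto)

lemma quasi_star_ideal_closure:
  assumes E: "E \<in> Fbar D" "E \<subseteq> D"
  shows "quasi_star_ideal D star (star E \<inter> D)"
proof -
  have sub: "submodule D (star E \<inter> D)"
    by (intro submodule_Int Fbar_submodule star_Fbar E submodule_self D)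
  have EsE: "E \<subseteq> star E \<inter> D" using star_extensive[OF E(1)] E(2) by blast
  have Fb: "star E \<inter> D \<in> Fbar D" using Fbar_superset[OF E(1) EsE sub] .
  have "star (star E \<inter> D) \<subseteq> star E"
    using star_mono[OF Fb star_Fbar[OF E(1)]] star_idem[OF E(1)] by auto
  then have "star (star E \<inter> D) \<inter> D = star E \<inter> D"
    using star_extensive[OF Fb] by blast
  then show ?thesis
    using sub Fb by (auto simp: quasi_star_ideal_def is_ideal_def Fbar_def)
qed

section \<open>Quasi-star-maximal ideals\<close>

text \<open>Zorn's lemma applies because the union of a chain of proper quasi-star-ideals is again one:
  by finite type, an element of the closure of the union comes from a finitely generated submodule,
  and that lies in one member of the chain.\<close>

lemma exists_quasi_star_maximal:
  assumes J: "quasi_star_ideal D star J" "J \<noteq> D"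
  obtains Q where "Q \<in> quasi_star_maximal D star" "J \<subseteq> Q"
proof -
  let ?A = "{P. quasi_star_ideal D star P \<and> P \<noteq> D \<and> J \<subseteq> P}"
  have "\<exists>Q\<in>?A. \<forall>P\<in>?A. Q \<subseteq> P \<longrightarrow> P = Q"
  proof (rule subset_Zorn_nonempty)
    show "?A \<noteq> {}" using J by auto
    fix C assume ne: "C \<noteq> {}" and chain: "subset.chain ?A C"
    have CA: "P \<in> ?A" if "P \<in> C" for P
      using chain that by (auto simp: subset.chain_def)
    have subm: "submodule D P" "P \<subseteq> D" "star P \<inter> D = P" if "P \<in> C" for P
      using CA[OF that] by (auto simp: quasi_star_ideal_def is_ideal_def)
    have linear: "P \<subseteq> P' \<or> P' \<subseteq> P" if "P \<in> C" "P' \<in> C" for P P'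
      using chain that unfolding subset_chain_def by blast
    obtain P0 where P0: "P0 \<in> C" using ne by blast
    have sub: "submodule D (\<Union>C)"
    proof (rule submoduleI)
      show "0 \<in> \<Union>C" using P0 subm submodule_0 by blast
    next
      fix x y assume "x \<in> \<Union>C" "y \<in> \<Union>C"
      then obtain P where "P \<in> C" "x \<in> P" "y \<in> P" using linear by blast
      then show "x + y \<in> \<Union>C" using submodule_add[OF subm(1)] by blast
    next
      fix r x assume "r \<in> D" "x \<in> \<Union>C"
      then show "r * x \<in> \<Union>C" using submodule_mult[OF subm(1)] by blast
    qed
    have "P0 \<in> Fbar D" using CA[OF P0] quasi_star_ideal_Fbar by blast
    then have Fb: "\<Union>C \<in> Fbar D"
      using P0 sub by (blast intro: Fbar_superset)
    have "z \<in> \<Union>C" if z: "z \<in> star (\<Union>C)" "z \<in> D" for z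
    proof -
      obtain F where F: "F \<in> Fbar D" "fin_gen D F" "F \<subseteq> \<Union>C" "z \<in> star F"
        using star_finite_type[OF Fb z(1)] .
      then obtain S where S: "finite S" "F = mspan D S" by (auto simp: fin_gen_def)
      then have "S \<subseteq> \<Union>C" using F(3) mspan_superset[of S D] by simp
      then obtain P where P: "P \<in> C" "S \<subseteq> P"
        using finite_subset_Union_chain[OF S(1) _ ne chain] by blast
      then have "F \<subseteq> P" using S(2) mspan_minimal subm(1) by blast
      moreover have "P \<in> Fbar D" using CA[OF P(1)] quasi_star_ideal_Fbar by blast
      ultimately have "z \<in> star P" using star_mono F by blast
      then show ?thesis using subm(3)[OF P(1)] z(2) P(1) by blast
    qed
    then have "star (\<Union>C) \<inter> D = \<Union>C"
      using star_extensive[OF Fb] subm(2) by blast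
    then have qs: "quasi_star_ideal D star (\<Union>C)"
      using sub subm(2) Fb by (auto simp: quasi_star_ideal_def is_ideal_def Fbar_def)
    have "1 \<notin> \<Union>C" using CA quasi_star_ideal_eq_D_iff by blast
    then have "\<Union>C \<noteq> D" using quasi_star_ideal_eq_D_iff[OF qs] by blast
    moreover have "J \<subseteq> \<Union>C" using CA[OF P0] P0 by blast
    ultimately show "\<Union>C \<in> ?A" using qs by blast
  qed
  then obtain Q where Q: "Q \<in> ?A" "\<forall>P\<in>?A. Q \<subseteq> P \<longrightarrow> P = Q" by (rule bexE)
  then have "Q \<in> quasi_star_maximal D star"
    unfolding quasi_star_maximal_def by auto
  with Q(1) that show ?thesis by blast
qed

lemma quasi_star_maximalD:
  assumes "Q \<in> quasi_star_maximal D star"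
  shows "submodule D Q" "Q \<subseteq> D" "star Q \<inter> D = Q" "Q \<in> Fbar D" "1 \<notin> Q"
  using assms quasi_star_ideal_eq_D_iff quasi_star_ideal_Fbar
  by (auto simp: quasi_star_maximal_def quasi_star_ideal_def is_ideal_def)

text \<open>An ideal that the operation does not close up to \<open>star D\<close> has a proper quasi-star closure
  \<open>star E \<inter> D\<close>, and this lies below a maximal one. So the maximal ideals detect the condition
  \<open>star E = star D\<close>.\<close>

lemma star_eq_star_D_iff_quasi_star_maximal:
  assumes E: "E \<in> Fbar D" "E \<subseteq> D"
  shows "star E = star D \<longleftrightarrow> (\<forall>Q\<in>quasi_star_maximal D star. \<not> E \<subseteq> Q)"
proof
  assume eq: "star E = star D"
  show "\<forall>Q\<in>quasi_star_maximal D star. \<not> E \<subseteq> Q"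
  proof (intro ballI notI)
    fix Q assume Q: "Q \<in> quasi_star_maximal D star" "E \<subseteq> Q"
    have "star D \<subseteq> star Q"
      using star_mono[OF E(1) quasi_star_maximalD(4)[OF Q(1)] Q(2)] eq by simp
    then show False
      using D_subset_star_D quasi_star_maximalD(3,5)[OF Q(1)] subring_1[OF D] by blast
  qed
next
  assume max: "\<forall>Q\<in>quasi_star_maximal D star. \<not> E \<subseteq> Q"
  have "star E \<inter> D = D"
  proof (rule ccontr)
    assume "star E \<inter> D \<noteq> D"
    then obtain Q where "Q \<in> quasi_star_maximal D star" "star E \<inter> D \<subseteq> Q"
      using exists_quasi_star_maximal[OF quasi_star_ideal_closure[OF E]] by blast
    then show False using max E star_extensive[OF E(1)] by blast
  qed
  then have "1 \<in> star E" using subring_1[OF D] by blast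
  then show "star E = star D"
    using star_eq_star_D_iff[OF E(1)] E(2) D_subset_star_D by blast
qed

text \<open>If \<open>a\<close> is outside \<open>Q\<close>, maximality puts \<open>1\<close> into the closure of \<open>Q + a D\<close>. Multiplying by
  \<open>b\<close> moves that sum into \<open>Q\<close> when \<open>a b\<close> belongs to \<open>Q\<close>, and so puts \<open>b\<close> into the closure of
  \<open>Q\<close>.\<close>

lemma quasi_star_maximal_prime:
  assumes Q: "Q \<in> quasi_star_maximal D star"
    and ab: "a \<in> D" "b \<in> D" "a * b \<in> Q"
  shows "a \<in> Q \<or> b \<in> Q"
proof (rule ccontr)
  assume neg: "\<not> (a \<in> Q \<or> b \<in> Q)"
  note Q' = quasi_star_maximalD[OF Q]
  let ?E = "mspan D (insert a Q)"
  have sub: "submodule D ?E" by (rule submodule_mspan)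
  have QE: "insert a Q \<subseteq> ?E" by (rule mspan_superset)
  have ED: "?E \<subseteq> D" using Q'(2) ab(1) by (intro mspan_minimal submodule_self D) auto
  have EF: "?E \<in> Fbar D" using Fbar_superset[OF Q'(4) _ sub] QE by blast
  have "Q \<subseteq> star ?E \<inter> D" "a \<in> star ?E \<inter> D"
    using star_extensive[OF EF] QE ED by auto
  moreover have "P = D" if "quasi_star_ideal D star P" "Q \<subseteq> P" "P \<noteq> Q" for P
    using Q that unfolding quasi_star_maximal_def by blast
  ultimately have "star ?E \<inter> D = D"
    using quasi_star_ideal_closure[OF EF ED] neg by metis
  then have one: "1 \<in> star ?E" using subring_1[OF D] by blast
  have b0: "b \<noteq> 0" using neg submodule_0[OF Q'(1)] by metis
  have "?E \<subseteq> {x. b * x \<in> Q}"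
    using ab(3) submodule_mult[OF Q'(1) ab(2)]
    by (intro mspan_minimal submodule_vimage_mult Q'(1)) (auto simp: mult.commute[of b a])
  then have bE: "(\<lambda>y. b * y) ` ?E \<subseteq> Q" by auto
  have "(\<lambda>y. b * y) ` ?E \<in> Fbar D"
    using Fbar_nonzero[OF EF] b0
    by (metis FbarI image_eqI no_zero_divisors sub submodule_image_mult)
  then have "star ((\<lambda>y. b * y) ` ?E) \<subseteq> star Q"
    using star_mono Q'(4) bE by blast
  then have "(\<lambda>y. b * y) ` star ?E \<subseteq> star Q"
    unfolding star_mult[OF EF b0] .
  with one have "b * 1 \<in> star Q" by blast
  then show False using ab(2) Q'(3) neg by auto
qed

section \<open>The multiplicative set of the Nagata ring\<close>

lemma poly_content_Fbar:
  assumes "h \<noteq> 0"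
  shows "poly_content D h \<in> Fbar D"
proof (rule FbarI)
  show "submodule D (poly_content D h)"
    unfolding poly_content_def by (rule submodule_mspan)
  show "lead_coeff h \<in> poly_content D h"
    unfolding poly_content_def using coeff_in_coeffs[OF assms, of "degree h"] by (intro mspan_base) simp
qed (use assms in simp)

lemma poly_content_subset_iff:
  assumes "submodule D E"
  shows "poly_content D h \<subseteq> E \<longleftrightarrow> h \<in> polys E"
proof -
  have "poly_content D h \<subseteq> E \<longleftrightarrow> set (coeffs h) \<subseteq> E"
    unfolding poly_content_def
    by (meson assms mspan_minimal mspan_superset subset_trans)
  then show ?thesis
    using set_coeffs_subset_iff[OF submodule_0[OF assms]] by simp
qed

lemma Nag_mult_iff:
  assumes "h \<in> polys D" "h \<noteq> 0"
  shows "h \<in> Nag_mult D star \<longleftrightarrow> (\<forall>Q\<in>quasi_star_maximal D star. h \<notin> polys Q)"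
proof -
  have "poly_content D h \<subseteq> D"
    using assms(1) poly_content_subset_iff[OF submodule_self[OF D]] by blast
  then have "h \<in> Nag_mult D star \<longleftrightarrow>
      (\<forall>Q\<in>quasi_star_maximal D star. \<not> poly_content D h \<subseteq> Q)"
    using assms star_eq_star_D_iff_quasi_star_maximal[OF poly_content_Fbar[OF assms(2)]]
    by (simp add: Nag_mult_def)
  also have "\<dots> \<longleftrightarrow> (\<forall>Q\<in>quasi_star_maximal D star. h \<notin> polys Q)"
    using poly_content_subset_iff[OF quasi_star_maximalD(1)] by blast
  finally show ?thesis .
qed

lemma one_Nag_mult: "1 \<in> Nag_mult D star"
proof -
  have "1 \<notin> polys Q" if "Q \<in> quasi_star_maximal D star" for Q
  proof
    assume "1 \<in> polys Q"
    then have "coeff 1 0 \<in> Q" unfolding polys_def by (simp only: mem_Collect_eq)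
    then show False using quasi_star_maximalD(5)[OF that] by simp
  qed
  then show ?thesis
    using Nag_mult_iff[of 1] subring_1[OF is_subring_polys[OF D]] by simp
qed

text \<open>By \<open>Nag_mult_iff\<close> the set consists of the nonzero polynomials over \<open>D\<close> outside all the prime
  ideals \<open>polys Q\<close>.\<close>

lemma mult_Nag_mult:
  assumes "f \<in> Nag_mult D star" "g \<in> Nag_mult D star"
  shows "f * g \<in> Nag_mult D star"
proof -
  have fg: "f \<in> polys D" "f \<noteq> 0" "g \<in> polys D" "g \<noteq> 0"
    using assms by (auto simp: Nag_mult_def)
  have "f * g \<notin> polys Q" if "Q \<in> quasi_star_maximal D star" for Q
    using polys_prime[OF D quasi_star_maximalD(1)[OF that] quasi_star_maximal_prime[OF that]]
      assms fg Nag_mult_iff that by blast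
  then show ?thesis
    using fg Nag_mult_iff[of "f * g"] subring_mult[OF is_subring_polys[OF D]] by simp
qed

text \<open>By finite type, \<open>1 \<in> star J\<close> is witnessed by finitely many elements of \<open>J\<close>; these are the
  coefficients of a polynomial.\<close>

lemma star_eq_star_D_iff_Nag_mult:
  assumes J: "J \<in> Fbar D" "J \<subseteq> D"
  shows "star J = star D \<longleftrightarrow> (\<exists>h\<in>Nag_mult D star. h \<in> polys J)"
proof
  assume "star J = star D"
  then have "1 \<in> star J" using D_subset_star_D subring_1[OF D] by blast
  then obtain F where F: "F \<in> Fbar D" "fin_gen D F" "F \<subseteq> J" "1 \<in> star F"
    using star_finite_type[OF J(1)] by blast
  then obtain xs where xs: "F = mspan D (set xs)"
    by (auto simp: fin_gen_def dest: finite_list)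
  define h where "h = Poly xs"
  have "nth_default 0 xs n \<in> F" for n
    using xs mspan_superset[of "set xs" D] submodule_0[OF Fbar_submodule[OF F(1)]]
    by (cases "n < length xs") (auto simp: nth_default_def)
  then have hF: "h \<in> polys F"
    by (simp add: h_def polys_def coeff_Poly_eq)
  have "xs ! i \<in> poly_content D h" if "i < length xs" for i
  proof -
    have "h \<in> polys (poly_content D h)"
      using poly_content_subset_iff[of "poly_content D h" h] submodule_mspan
      unfolding poly_content_def by blast
    then have "coeff h i \<in> poly_content D h" by (auto simp: polys_def)
    then show ?thesis using that by (simp add: h_def coeff_Poly_eq nth_default_nth)
  qed
  then have Fh: "F \<subseteq> poly_content D h"
    unfolding xs poly_content_def
    by (intro mspan_minimal submodule_mspan) (auto simp: in_set_conv_nth)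
  obtain x where "x \<in> F" "x \<noteq> 0" using Fbar_nonzero[OF F(1)] .
  moreover have "poly_content D 0 \<subseteq> {0}"
    unfolding poly_content_def by (intro mspan_minimal) (auto simp: submodule_def)
  ultimately have h0: "h \<noteq> 0" using Fh by blast
  note hFb = poly_content_Fbar[OF h0]
  have hD: "h \<in> polys D" using hF F(3) J(2) by (auto simp: polys_def)
  then have "poly_content D h \<subseteq> D"
    using poly_content_subset_iff[OF submodule_self[OF D]] by blast
  moreover have "1 \<in> star (poly_content D h)"
    using star_mono[OF F(1) hFb Fh] F(4) by blast
  ultimately have "star (poly_content D h) = star D"
    using star_eq_star_D_iff[OF hFb] D_subset_star_D by blast
  then have "h \<in> Nag_mult D star" using hD h0 by (simp add: Nag_mult_def)
  moreover have "h \<in> polys J" using hF F(3) by (auto simp: polys_def)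
  ultimately show "\<exists>h\<in>Nag_mult D star. h \<in> polys J" ..
next
  assume "\<exists>h\<in>Nag_mult D star. h \<in> polys J"
  then obtain h where h: "h \<noteq> 0" "star (poly_content D h) = star D" "h \<in> polys J"
    by (auto simp: Nag_mult_def)
  then have "star D \<subseteq> star J"
    using star_mono[OF poly_content_Fbar[OF h(1)] J(1)]
      poly_content_subset_iff[OF Fbar_submodule[OF J(1)]] by auto
  moreover have "star J \<subseteq> star D" using star_mono[OF J(1) D_Fbar J(2)] .
  ultimately show "star J = star D" by blast
qed

section \<open>Invertibility of a finitely generated module\<close>

lemma exists_denominator:
  assumes "finite F"
  shows "\<exists>d\<in>D. d \<noteq> 0 \<and> d \<in> colon D F"
  using assms
proof (induction F rule: finite_induct)
  case empty
  then show ?case using subring_1[OF D] by (auto simp: colon_def intro!: bexI[of _ 1])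
next
  case (insert x F)
  then obtain d where d: "d \<in> D" "d \<noteq> 0" "\<forall>y\<in>F. d * y \<in> D" by (auto simp: colon_def)
  obtain a b where ab: "a \<in> D" "b \<in> D" "b \<noteq> 0" "x = a / b"
    using quotient_field unfolding domain_with_quotient_field_def by blast
  have "b * d * y \<in> D" if "y \<in> insert x F" for y
  proof (cases "y = x")
    case True
    then have "b * d * y = d * a" using ab by simp
    also have "\<dots> \<in> D" using d(1) ab(1) by (rule subring_mult[OF D])
    finally show ?thesis .
  next
    case False
    then show ?thesis
      using that d ab subring_mult[OF D ab(2), of "d * y"] by (simp add: mult.assoc)
  qed
  then show ?case
    using subring_mult[OF D ab(2) d(1)] ab(3) d(2)
    by (auto simp: colon_def intro!: bexI[of _ "b * d"])
qed

lemma colon_finite_Fbar: "finite F \<Longrightarrow> colon D F \<in> Fbar D"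
  using exists_denominator FbarI submodule_colon[OF submodule_self[OF D]] by metis

text \<open>For a single \<open>x \<noteq> 0\<close>, the module \<open>(star D : x)\<close> is the multiple of \<open>star D\<close> by \<open>1 / x\<close>,
  and so the closure of \<open>(D : x)\<close>. Stability carries this through a finite intersection.\<close>

lemma colon_star_D_subset:
  assumes "finite F"
  shows "colon (star D) F \<subseteq> star (colon D F)"
  using assms
proof (induction F rule: finite_induct)
  case empty
  have "colon D {} \<subseteq> star (colon D {})"
    by (intro star_extensive colon_finite_Fbar) simp
  then show ?case by (simp add: colon_def)
next
  case (insert x F)
  have split: "colon E (insert x F) = colon E {x} \<inter> colon E F" for E
    by (auto simp: colon_def)
  have "colon (star D) {x} \<subseteq> star (colon D {x})"
  proof (cases "x = 0")
    case True
    have "colon D {x} = UNIV"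
      using True subring_0[OF D] by (simp add: colon_def)
    then show ?thesis
      using star_extensive[OF colon_finite_Fbar[of "{x}"]] by auto
  next
    case False
    have eq: "colon E {x} = (\<lambda>y. (1 / x) * y) ` E" for E
    proof (intro equalityI subsetI)
      fix z assume "z \<in> colon E {x}"
      then show "z \<in> (\<lambda>y. (1 / x) * y) ` E"
        using False by (intro image_eqI[of _ _ "z * x"]) (auto simp: colon_def)
    qed (use False in \<open>auto simp: colon_def\<close>)
    have "star ((\<lambda>y. (1 / x) * y) ` D) = (\<lambda>y. (1 / x) * y) ` star D"
      using False by (intro star_mult D_Fbar) simp
    then show ?thesis unfolding eq by simp
  qed
  then show ?case
    unfolding split using insert star_Int[of "colon D {x}" "colon D F"] colon_finite_Fbar by auto
qed

context
  fixes I F :: "'k set"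
  assumes I: "submodule D I" "I \<noteq> {0}" and F: "finite F" "I = mspan D F"
begin

lemma obtain_nonzero:
  obtains x where "x \<in> I" "x \<noteq> 0"
  using I submodule_0 by blast

lemma obtain_denominator:
  obtains d where "d \<noteq> 0" "d \<in> D" "d \<in> colon D I"
  using exists_denominator[OF F(1)] that unfolding F(2)
  by (auto simp: colon_mspan submodule_self D)

lemma F_subset_I: "F \<subseteq> I"
  unfolding F(2) by (rule mspan_superset)

lemma colon_Fbar: "colon D I \<in> Fbar D"
  using obtain_denominator FbarI submodule_colon[OF submodule_self[OF D]] by metis

lemma product_subset_D: "mprod D I (colon D I) \<subseteq> D"
  unfolding mprod_def
  by (intro mspan_minimal submodule_self D) (auto simp: colon_def mult.commute)

lemma product_Fbar: "mprod D I (colon D I) \<in> Fbar D"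
proof -
  obtain d where d: "d \<noteq> 0" "d \<in> D" "d \<in> colon D I" by (rule obtain_denominator)
  obtain x where x: "x \<in> I" "x \<noteq> 0" by (rule obtain_nonzero)
  show ?thesis
  proof (rule FbarI)
    show "x * d \<in> mprod D I (colon D I)"
      unfolding mprod_def using x d by (intro mspan_base) blast
  qed (use x d in \<open>auto simp: mprod_def submodule_mspan\<close>)
qed

lemma star_invertible_iff: "star_invertible D star I \<longleftrightarrow> star (mprod D I (colon D I)) = star D"
proof -
  have "fractional_ideal D I"
    unfolding fractional_ideal_def
    by (rule obtain_denominator) (use I in \<open>auto simp: colon_def\<close>)
  then show ?thesis using I unfolding star_invertible_def by simp
qed

text \<open>The multiplicative set is the complement of a prime ideal of \<open>D\<close>, so meeting it means not
  being contained in the prime.\<close>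

lemma invertible_localization_iff:
  assumes Q: "Q \<in> quasi_star_maximal D star"
  shows "invertible_fractional_ideal (localization_at D Q) (mspan (localization_at D Q) I) \<longleftrightarrow>
    \<not> mprod D I (colon D I) \<subseteq> Q"
proof -
  note Q' = quasi_star_maximalD[OF Q]
  obtain d where d: "d \<noteq> 0" "d \<in> D" "d \<in> colon D I" by (rule obtain_denominator)
  have "invertible_fractional_ideal (localization_at D Q) (mspan (localization_at D Q) I) \<longleftrightarrow>
      (\<exists>s\<in>D - Q. s \<in> mspan D {g * v | g v. g \<in> I \<and> v \<in> colon D I})"
    unfolding localization_at_def
  proof (rule invertible_over_fractions_iff[OF D])
    show "s * t \<in> D - Q" if "s \<in> D - Q" "t \<in> D - Q" for s t
      using that quasi_star_maximal_prime[OF Q] subring_mult[OF D] by blast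
    show "\<exists>g\<in>I. g \<noteq> 0" using obtain_nonzero by metis
  qed (use Q' subring_1[OF D] submodule_0 F F_subset_I d in auto)
  then show ?thesis
    using product_subset_D unfolding mprod_def by blast
qed

lemma principal_localization:
  assumes Q: "Q \<in> quasi_star_maximal D star"
    and inv: "invertible_fractional_ideal (localization_at D Q) (mspan (localization_at D Q) I)"
  shows "is_principal (localization_at D Q) (mspan (localization_at D Q) I)"
proof -
  note Q' = quasi_star_maximalD[OF Q]
  have "\<not> {g * v | g v. g \<in> I \<and> v \<in> colon D I} \<subseteq> Q"
    using inv mspan_minimal[OF _ Q'(1)] unfolding invertible_localization_iff[OF Q] mprod_def by blast
  then obtain g v where gv: "g \<in> I" "v \<in> colon D I" "g * v \<notin> Q" by blast
  then have "g * v \<in> D - Q" by (simp add: colon_def mult.commute)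
  then show ?thesis
    unfolding localization_at_def
    using is_principal_if_unit_product[OF gv(1,2)] submodule_0[OF Q'(1)] by blast
qed

lemma invertible_Na_iff:
  "invertible_fractional_ideal (Na D star) (mspan (Na D star) (const_fract ` I)) \<longleftrightarrow>
    star (mprod D I (colon D I)) = star D"
proof -
  let ?A = "to_fract ` polys D" and ?S = "to_fract ` Nag_mult D star"
  let ?G = "const_fract ` I"
  obtain d where d: "d \<noteq> 0" "d \<in> D" "d \<in> colon D I" by (rule obtain_denominator)
  obtain x where x: "x \<in> I" "x \<noteq> 0" by (rule obtain_nonzero)
  have A: "is_subring ?A" by (intro is_subring_to_fract_image is_subring_polys D)
  have const_A: "const_fract c \<in> ?A" if "c \<in> D" for c
    using that const_fract_in_polys_iff[OF subring_0[OF D]] by blast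
  have "submodule D {c. const_fract c \<in> mspan ?A (const_fract ` F)}"
    by (rule submoduleI)
       (auto simp: const_fract_add const_fract_mult const_A
         intro: submodule_0[OF submodule_mspan] submodule_add[OF submodule_mspan]
           submodule_mult[OF submodule_mspan])
  then have "I \<subseteq> {c. const_fract c \<in> mspan ?A (const_fract ` F)}"
    unfolding F(2) by (intro mspan_minimal) (auto intro: mspan_base)
  then have gen: "?G \<subseteq> mspan ?A (const_fract ` F)" by blast
  have "invertible_fractional_ideal (Na D star) (mspan (Na D star) ?G) \<longleftrightarrow>
      (\<exists>s\<in>?S. s \<in> mspan ?A {g * v | g v. g \<in> ?G \<and> v \<in> colon ?A ?G})"
    unfolding Na_def
  proof (rule invertible_over_fractions_iff[OF A _ _ _ _ _ _ gen])
    show "1 \<in> ?S" using one_Nag_mult by (force intro: image_eqI[of _ _ 1])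
    show "s * t \<in> ?S" if "s \<in> ?S" "t \<in> ?S" for s t
      using that mult_Nag_mult by (auto simp flip: to_fract_mult)
    show "\<exists>g\<in>?G. g \<noteq> 0" using x by auto
    show "const_fract d \<noteq> 0" "const_fract d \<in> ?A" "const_fract d \<in> colon ?A ?G"
      using d const_A by (auto simp: colon_def simp flip: const_fract_mult)
  qed (use F F_subset_I in \<open>auto simp: Nag_mult_def\<close>)
  also have "\<dots> \<longleftrightarrow> (\<exists>h\<in>Nag_mult D star. h \<in> polys (mprod D I (colon D I)))"
    unfolding mspan_polys_product_colon[OF D x] by auto
  also have "\<dots> \<longleftrightarrow> star (mprod D I (colon D I)) = star D"
    using star_eq_star_D_iff_Nag_mult[OF product_Fbar product_subset_D] by blast
  finally show ?thesis .
qed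

text \<open>Replacing \<open>(D : I)\<close> by \<open>(star D : I)\<close> enlarges the product only within its closure, because
  multiplication by an element of \<open>I\<close> commutes with the operation.\<close>

lemma product_colon_star_D_subset:
  "mprod D I (colon (star D) I) \<subseteq> star (mprod D I (colon D I))"
  unfolding mprod_def[of D I "colon (star D) I"]
proof (rule mspan_minimal)
  let ?J = "mprod D I (colon D I)"
  show sub: "submodule D (star ?J)"
    by (intro Fbar_submodule star_Fbar product_Fbar)
  show "{x * y | x y. x \<in> I \<and> y \<in> colon (star D) I} \<subseteq> star ?J"
  proof clarify
    fix x y assume x: "x \<in> I" and "y \<in> colon (star D) I"
    then have "y \<in> colon (star D) F"
      using F_subset_I by (auto simp: colon_def)
    then have "y \<in> star (colon D F)" using colon_star_D_subset[OF F(1)] by blast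
    then have y: "y \<in> star (colon D I)"
      unfolding F(2) by (simp add: colon_mspan submodule_self D)
    show "x * y \<in> star ?J"
    proof (cases "x = 0")
      case True
      then show ?thesis using submodule_0[OF sub] by simp
    next
      case False
      let ?xC = "(\<lambda>y. x * y) ` colon D I"
      obtain d where "d \<noteq> 0" "d \<in> colon D I" by (rule obtain_denominator)
      then have "?xC \<in> Fbar D"
        using False submodule_image_mult[OF Fbar_submodule[OF colon_Fbar]]
        by (intro FbarI[of _ "x * d"]) auto
      moreover have "?xC \<subseteq> ?J"
        unfolding mprod_def using x by (auto intro!: mspan_base)
      ultimately have "star ?xC \<subseteq> star ?J"
        using star_mono product_Fbar by blast
      then show ?thesis using y star_mult[OF colon_Fbar False] by blast
    qed
  qed
qed

lemma quasi_star_invertible_iff: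
  "quasi_star_invertible D star I \<longleftrightarrow> star (mprod D I (colon D I)) = star D"
proof -
  let ?J = "mprod D I (colon D I)" and ?J' = "mprod D I (colon (star D) I)"
  have "?J \<subseteq> ?J'"
    unfolding mprod_def using D_subset_star_D by (intro mspan_mono) (auto simp: colon_def)
  moreover have "submodule D ?J'" unfolding mprod_def by (rule submodule_mspan)
  ultimately have J': "?J' \<in> Fbar D"
    using Fbar_superset[OF product_Fbar] by blast
  have "star ?J' \<subseteq> star ?J"
    using star_mono[OF J' star_Fbar[OF product_Fbar] product_colon_star_D_subset]
      star_idem[OF product_Fbar] by simp
  moreover have "star ?J \<subseteq> star ?J'"
    using star_mono[OF product_Fbar J' \<open>?J \<subseteq> ?J'\<close>] .
  ultimately have "star ?J' = star ?J" by blast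
  then show ?thesis
    using I J' unfolding quasi_star_invertible_def by (simp add: Fbar_def)
qed

end

end

theorem corollary2p24:
  fixes D :: "'k::field set"
    and star :: "'k set \<Rightarrow> 'k set"
    and I :: "'k set"
  assumes "domain_with_quotient_field D"
    and "semistar_operation D star"
    and "stable_semistar D star"
    and "finite_type D star"
    and "submodule D I" and "I \<noteq> {0}" and "fin_gen D I"
  shows "(star_invertible D star I \<longleftrightarrow>
            (\<forall>Q\<in>quasi_star_maximal D star.
               invertible_fractional_ideal (localization_at D Q) (mspan (localization_at D Q) I)))
       \<and> (star_invertible D star I \<longleftrightarrow>
            invertible_fractional_ideal (Na D star) (mspan (Na D star) (const_fract ` I)))
       \<and> (star_invertible D star I \<longleftrightarrow> quasi_star_invertible D star I)
       \<and> (\<forall>Q\<in>quasi_star_maximal D star.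
            invertible_fractional_ideal (localization_at D Q) (mspan (localization_at D Q) I) \<longrightarrow>
            is_principal (localization_at D Q) (mspan (localization_at D Q) I))"
proof -
  interpret stable_finite_semistar D star
    using assms(1-4) by unfold_locales
  obtain F where F: "finite F" "I = mspan D F"
    using assms(7) by (auto simp: fin_gen_def)
  note I = assms(5,6) F
  have "star_invertible D star I \<longleftrightarrow>
      (\<forall>Q\<in>quasi_star_maximal D star. \<not> mprod D I (colon D I) \<subseteq> Q)"
    using star_invertible_iff[OF I]
      star_eq_star_D_iff_quasi_star_maximal[OF product_Fbar[OF I] product_subset_D[OF I]]
    by simp
  then show ?thesis
    using star_invertible_iff[OF I] invertible_localization_iff[OF I] invertible_Na_iff[OF I]
      quasi_star_invertible_iff[OF I] principal_localization[OF I]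
    by simp
qed

end
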